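(* Let $Y$ be a quasiconformal Jordan domain. Suppose that $\partial Y$ is a quasicircle and that there exists $C_U > 0$ such that for all $y \in \partial Y$ and $0 < r < \operatorname{diam} \partial Y$, $$\mathcal{H}^{2}_{\overline{Y}}(\overline{B}_{\overline{Y}}(y,r)) \leq C_U r^{2}.$$ Then the Assouad dimension of $\partial Y$ is at most two.
   Context: $\mathbb{D}$ is the open unit disk in $\mathbb{R}^{2}$, $\overline{\mathbb{D}}$ its closure, $\mathbb{S}^{1}$ its boundary circle (with the Euclidean metric). $\mathcal{H}^{2}_{Z}$ denotes the Hausdorff $2$-measure of a metric space $Z$, normalized so that $\mathcal{H}^2_{\mathbb{R}^2}$ is Lebesgue measure. $B_Z(y,r)$ and $\overline{B}_Z(y,r)$ are the open and closed balls. Modulus: let $Z$ be a metric space with locally finite $\mathcal{H}^2_Z$ and $\Gamma$ a family of paths in $Z$. A Borel function $\rho \colon Z \to [0,\infty]$ is admissible for $\Gamma$ if $\int_{\gamma} \rho\, ds \geq 1$ for every rectifiable $\gamma \in \Gamma$. The modulus is $\operatorname{Mod}\Gamma = \inf \int_Z \rho^2 \, d\mathcal{H}^2_Z$, the infimum over all admissible $\rho$. A homeomorphism $\psi \colon Z \to W$ between metric spaces with locally finite Hausdorff $2$-measure is quasiconformal if there is $K\geq 1$ with $K^{-1}\operatorname{Mod}\Gamma \leq \operatorname{Mod}\psi\Gamma \leq K \operatorname{Mod}\Gamma$ for all path families $\Gamma$ in $Z$, where $\psi\Gamma = \{\psi\circ\gamma : \gamma\in\Gamma\}$. A metric surface is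 a metric space homeomorphic to a $2$-manifold and with locally finite Hausdorff $2$-measure. A metric surface $(Y,d_Y)$ is a metric Jordan domain if its metric completion $\overline{Y}$ is homeomorphic to $\overline{\mathbb{D}}$, the boundary $\partial Y = \overline{Y}\setminus Y$ is homeomorphic to $\mathbb{S}^1$, and $\mathcal{H}^2_{\overline{Y}}(\overline{Y}) < \infty$. It is a quasiconformal Jordan domain if in addition there exists a quasiconformal homeomorphism $\mathbb{D}\to Y$. Quasisymmetry: a homeomorphism $g\colon (Z,d_Z)\to(W,d_W)$ is quasisymmetric if there is a homeomorphism $\eta\colon[0,\infty)\to[0,\infty)$ such that for every $z\in Z$ and $0<r_1,r_2<\operatorname{diam}Z$, $\sup_{w\in\overline{B}_Z(z,r_1)}d_W(g(z),g(w))\leq\eta(r_1/r_2)\inf_{w\in Z\setminus B_Z(z,r_2)}d_W(g(z),g(w))$. A quasicircle is a metric space that is a quasisymmetric image of $\mathbb{S}^1$. Assouad dimension: a set $S$ is $s$-separated if distinct points of $S$ are at distance at least $s$. A metric space $Z$ has Assouad dimension bounded from above by $Q>0$ if there is a constant $C$ such that for every $0<\epsilon<1$, every $z\in Z$ and $0<r<\operatorname{diam}Z$, every $\epsilon r$-separated set $S\subset B_Z(z,r)$ has cardinality $\#S\leq C\epsilon^{-Q}$. The Assouad dimension of $Z$ is the infimum of such $Q$. *)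

theory Defs
  imports "HOL-Analysis.Analysis"
begin

text \<open>Diameters take values in \<open>[0, \<infinity>]\<close>; the empty set has diameter \<open>0\<close>.\<close>

definition ediam :: "'a metric \<Rightarrow> 'a set \<Rightarrow> ennreal" where
  "ediam Z A = (SUP x\<in>A. SUP y\<in>A. ennreal (mdist Z x y))"

section \<open>Hausdorff 2-measure\<close>

text \<open>The factor \<open>\<pi> / 4\<close> is the area of the planar disk of diameter \<open>1\<close>, so that
  the Hausdorff 2-measure of the Euclidean plane is Lebesgue measure.\<close>

definition hausdorff2_premeasure :: "'a metric \<Rightarrow> real \<Rightarrow> 'a set \<Rightarrow> ennreal" where
  "hausdorff2_premeasure Z \<delta> A =
     (INF C \<in> {C :: nat \<Rightarrow> 'a set. (\<forall>i. C i \<subseteq> mspace Z \<and> ediam Z (C i) \<le> ennreal \<delta>)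
                                  \<and> A \<subseteq> (\<Union>i. C i)}.
        \<Sum>i. ennreal (pi / 4) * ediam Z (C i) ^ 2)"

definition hausdorff2 :: "'a metric \<Rightarrow> 'a set \<Rightarrow> ennreal" where
  "hausdorff2 Z A = (SUP \<delta> \<in> {0<..}. hausdorff2_premeasure Z \<delta> A)"

text \<open>\<open>hausdorff2 Z\<close> is a metric outer measure, hence countably additive on the Borel sets by
  Caratheodory's criterion, so \<open>measure_of\<close> does not fall back to the zero measure here.\<close>

definition hausdorff2_measure :: "'a metric \<Rightarrow> 'a measure" where
  "hausdorff2_measure Z =
     measure_of (mspace Z) {U. openin (mtopology_of Z) U} (hausdorff2 Z)"

definition locally_finite_hausdorff2 :: "'a metric \<Rightarrow> bool" where
  "locally_finite_hausdorff2 Z \<longleftrightarrow>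
     (\<forall>z\<in>mspace Z. \<exists>U. openin (mtopology_of Z) U \<and> z \<in> U \<and> hausdorff2 Z U < \<infinity>)"

section \<open>Path integrals and modulus\<close>

text \<open>Paths are parametrized by \<open>{0..1}\<close>, as in \<^const>\<open>pathin\<close>; lengths and path integrals do not
  depend on the parametrization, nor on values outside \<open>{0..1}\<close>.\<close>

definition path_length_on :: "'a metric \<Rightarrow> (real \<Rightarrow> 'a) \<Rightarrow> real \<Rightarrow> real \<Rightarrow> ennreal" where
  "path_length_on Z \<gamma> a b =
     (SUP ts \<in> {ts. sorted ts \<and> set ts \<subseteq> {a..b}}.
        \<Sum>i<length ts - 1. ennreal (mdist Z (\<gamma> (ts ! i)) (\<gamma> (ts ! Suc i))))"

definition rectifiable_path_in :: "'a metric \<Rightarrow> (real \<Rightarrow> 'a) \<Rightarrow> bool" where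
  "rectifiable_path_in Z \<gamma> \<longleftrightarrow> pathin (mtopology_of Z) \<gamma> \<and> path_length_on Z \<gamma> 0 1 < \<infinity>"

text \<open>The parametrization of a rectifiable path by arc length, on \<open>{0..enn2real (path_length_on Z \<gamma> 0 1)}\<close>.
  Every \<open>s\<close> in this interval is the length of some initial piece \<open>\<gamma>|{0..t}\<close>, and \<open>\<gamma> t\<close> is
  independent of the choice of \<open>t\<close>.\<close>

definition arc_length_param :: "'a metric \<Rightarrow> (real \<Rightarrow> 'a) \<Rightarrow> real \<Rightarrow> 'a" where
  "arc_length_param Z \<gamma> s =
     \<gamma> (SOME t. t \<in> {0..1} \<and> path_length_on Z \<gamma> 0 t = ennreal s)"

definition path_integral :: "'a metric \<Rightarrow> (real \<Rightarrow> 'a) \<Rightarrow> ('a \<Rightarrow> ennreal) \<Rightarrow> ennreal" where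
  "path_integral Z \<gamma> \<rho> =
     (\<integral>\<^sup>+ s \<in> {0..enn2real (path_length_on Z \<gamma> 0 1)}. \<rho> (arc_length_param Z \<gamma> s) \<partial>lborel)"

definition admissible :: "'a metric \<Rightarrow> (real \<Rightarrow> 'a) set \<Rightarrow> ('a \<Rightarrow> ennreal) \<Rightarrow> bool" where
  "admissible Z \<Gamma> \<rho> \<longleftrightarrow>
     \<rho> \<in> borel_measurable (sigma (mspace Z) {U. openin (mtopology_of Z) U}) \<and>
     (\<forall>\<gamma>\<in>\<Gamma>. rectifiable_path_in Z \<gamma> \<longrightarrow> 1 \<le> path_integral Z \<gamma> \<rho>)"

definition modulus :: "'a metric \<Rightarrow> (real \<Rightarrow> 'a) set \<Rightarrow> ennreal" where
  "modulus Z \<Gamma> = (INF \<rho> \<in> {\<rho>. admissible Z \<Gamma> \<rho>}. \<integral>\<^sup>+ z. \<rho> z ^ 2 \<partial>hausdorff2_measure Z)"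

definition quasiconformal :: "'a metric \<Rightarrow> 'b metric \<Rightarrow> ('a \<Rightarrow> 'b) \<Rightarrow> bool" where
  "quasiconformal Z W \<psi> \<longleftrightarrow>
     locally_finite_hausdorff2 Z \<and> locally_finite_hausdorff2 W \<and>
     homeomorphic_map (mtopology_of Z) (mtopology_of W) \<psi> \<and>
     (\<exists>K::real. 1 \<le> K \<and>
        (\<forall>\<Gamma>. (\<forall>\<gamma>\<in>\<Gamma>. pathin (mtopology_of Z) \<gamma>) \<longrightarrow>
             ennreal (1 / K) * modulus Z \<Gamma> \<le> modulus W ((\<lambda>\<gamma>. \<psi> \<circ> \<gamma>) ` \<Gamma>) \<and>
             modulus W ((\<lambda>\<gamma>. \<psi> \<circ> \<gamma>) ` \<Gamma>) \<le> ennreal K * modulus Z \<Gamma>))"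

section \<open>Metric surfaces and Jordan domains\<close>

definition two_manifold :: "'a topology \<Rightarrow> bool" where
  "two_manifold X \<longleftrightarrow>
     Hausdorff_space X \<and> second_countable X \<and>
     (\<forall>x\<in>topspace X. \<exists>U V. openin X U \<and> x \<in> U \<and> open (V :: (real ^ 2) set) \<and>
        subtopology X U homeomorphic_space top_of_set V)"

definition metric_surface :: "'a metric \<Rightarrow> bool" where
  "metric_surface Y \<longleftrightarrow> two_manifold (mtopology_of Y) \<and> locally_finite_hausdorff2 Y"

text \<open>\<open>Z\<close>, together with the isometric embedding \<open>\<iota>\<close> of \<open>Y\<close> onto a dense subset, is a metric
  completion of \<open>Y\<close>. This determines \<open>(Z, \<iota>)\<close> up to isometry; for existence see
  \<open>Metric_space.metric_completion\<close>.\<close>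

definition is_completion :: "'a metric \<Rightarrow> 'b metric \<Rightarrow> ('a \<Rightarrow> 'b) \<Rightarrow> bool" where
  "is_completion Y Z \<iota> \<longleftrightarrow>
     mcomplete_of Z \<and>
     \<iota> \<in> mspace Y \<rightarrow> mspace Z \<and>
     (\<forall>x\<in>mspace Y. \<forall>y\<in>mspace Y. mdist Z (\<iota> x) (\<iota> y) = mdist Y x y) \<and>
     mtopology_of Z closure_of (\<iota> ` mspace Y) = mspace Z"

definition metric_boundary :: "'a metric \<Rightarrow> 'b metric \<Rightarrow> ('a \<Rightarrow> 'b) \<Rightarrow> 'b metric" where
  "metric_boundary Y Z \<iota> = submetric Z (mspace Z - \<iota> ` mspace Y)"

abbreviation unit_disk :: "(real ^ 2) metric" where
  "unit_disk \<equiv> submetric euclidean_metric (ball 0 1)"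

abbreviation closed_unit_disk :: "(real ^ 2) metric" where
  "closed_unit_disk \<equiv> submetric euclidean_metric (cball 0 1)"

abbreviation unit_circle :: "(real ^ 2) metric" where
  "unit_circle \<equiv> submetric euclidean_metric (sphere 0 1)"

text \<open>The completion is an argument of the following two predicates. All conditions on it are
  invariant under isometries, so they depend only on \<open>Y\<close>.\<close>

definition metric_Jordan_domain :: "'a metric \<Rightarrow> 'b metric \<Rightarrow> ('a \<Rightarrow> 'b) \<Rightarrow> bool" where
  "metric_Jordan_domain Y Ybar \<iota> \<longleftrightarrow>
     metric_surface Y \<and> is_completion Y Ybar \<iota> \<and>
     mtopology_of Ybar homeomorphic_space mtopology_of closed_unit_disk \<and>
     mtopology_of (metric_boundary Y Ybar \<iota>) homeomorphic_space mtopology_of unit_circle \<and>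
     hausdorff2 Ybar (mspace Ybar) < \<infinity>"

definition quasiconformal_Jordan_domain :: "'a metric \<Rightarrow> 'b metric \<Rightarrow> ('a \<Rightarrow> 'b) \<Rightarrow> bool" where
  "quasiconformal_Jordan_domain Y Ybar \<iota> \<longleftrightarrow>
     metric_Jordan_domain Y Ybar \<iota> \<and> (\<exists>\<psi>. quasiconformal unit_disk Y \<psi>)"

section \<open>Quasicircles\<close>

text \<open>If \<open>Z\<close> is contained in the ball of radius \<open>r2\<close> about \<open>z\<close>, the infimum below is \<open>\<infinity>\<close> and the
  inequality is void.\<close>

definition quasisymmetric :: "'a metric \<Rightarrow> 'b metric \<Rightarrow> ('a \<Rightarrow> 'b) \<Rightarrow> bool" where
  "quasisymmetric Z W g \<longleftrightarrow>
     homeomorphic_map (mtopology_of Z) (mtopology_of W) g \<and>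
     (\<exists>\<eta>::real \<Rightarrow> real. homeomorphic_map (top_of_set {0..}) (top_of_set {0..}) \<eta> \<and>
        (\<forall>z\<in>mspace Z. \<forall>r1 r2. 0 < r1 \<and> ennreal r1 < ediam Z (mspace Z) \<and>
                                0 < r2 \<and> ennreal r2 < ediam Z (mspace Z) \<longrightarrow>
           (SUP w \<in> mcball_of Z z r1. ennreal (mdist W (g z) (g w)))
             \<le> ennreal (\<eta> (r1 / r2)) *
               (INF w \<in> mspace Z - mball_of Z z r2. ennreal (mdist W (g z) (g w)))))"

definition quasicircle :: "'a metric \<Rightarrow> bool" where
  "quasicircle W \<longleftrightarrow> (\<exists>g. quasisymmetric unit_circle W g)"

section \<open>Assouad dimension\<close>

definition separated_set :: "'a metric \<Rightarrow> real \<Rightarrow> 'a set \<Rightarrow> bool" where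
  "separated_set Z s S \<longleftrightarrow> (\<forall>x\<in>S. \<forall>y\<in>S. x \<noteq> y \<longrightarrow> s \<le> mdist Z x y)"

definition assouad_dim_bounded :: "'a metric \<Rightarrow> real \<Rightarrow> bool" where
  "assouad_dim_bounded Z Q \<longleftrightarrow>
     (\<exists>C::real. \<forall>\<epsilon> z r S. 0 < \<epsilon> \<and> \<epsilon> < 1 \<and> z \<in> mspace Z \<and>
        0 < r \<and> ennreal r < ediam Z (mspace Z) \<and>
        S \<subseteq> mball_of Z z r \<and> separated_set Z (\<epsilon> * r) S \<longrightarrow>
          finite S \<and> real (card S) \<le> C * \<epsilon> powr (- Q))"

definition assouad_dim :: "'a metric \<Rightarrow> ereal" where
  "assouad_dim Z = (INF Q \<in> {Q. 0 < Q \<and> assouad_dim_bounded Z Q}. ereal Q)"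

end

theory Submission
  imports Defs
begin

text \<open>The boundary has Assouad dimension at most two because area is Ahlfors regular at boundary points:
  the upper bound \<open>area (B (y, r)) \<le> C r\<^sup>2\<close> is assumed, and a matching lower bound holds since
  \<open>\<partial>Y\<close> is a quasicircle. Given both, the balls of radius \<open>\<epsilon> r / 4\<close> around an \<open>\<epsilon> r\<close>-separated subset of
  \<open>\<partial>Y \<inter> B (z, r)\<close> are separated, lie in \<open>B (z, 2 r)\<close>, and have area at least a multiple of \<open>(\<epsilon> r)\<^sup>2\<close>
  each, so there are at most a multiple of \<open>1 / \<epsilon>\<^sup>2\<close> of them (\<open>assouad_dim_bounded_two\<close>).

  The lower bound (\<open>quasicircle_boundary_content_lower_bound\<close>) comes from Besicovitch's inequality: a
  topological quadrilateral whose two pairs of opposite sides are at distance at least \<open>s\<close> has area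
  at least a multiple of \<open>s\<^sup>2\<close>. Around \<open>y \<in> \<partial>Y\<close> and for a scale \<open>\<rho>\<close>, a quasisymmetric parametrization of
  \<open>\<partial>Y\<close> by the circle provides a decomposition of \<open>\<partial>Y\<close> into four arcs such that opposite ones are at
  distance at least \<open>s\<close>, a fixed multiple of \<open>\<rho>\<close>, and one of them lies in \<open>B (y, \<rho> / 4)\<close>. The four arcs
  form a loop; since the completion is homeomorphic to a closed disk, the loop extends to a
  continuous map of a square into the completion.

  Besicovitch's inequality (\<open>besicovitch_inequality\<close>) is proved by mapping the completion to the
  plane with the distances to two adjacent arcs as coordinates. By the Poincare-Miranda theorem the
  image of the square contains \<open>(0, s)\<^sup>2\<close>, and every value in \<open>(0, s)\<^sup>2\<close> is attained within \<open>s\<close> of the arc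
  near \<open>y\<close>, hence inside \<open>B (y, \<rho>)\<close>. Since both coordinates are 1-Lipschitz, the sum of the squared
  diameters of any cover of \<open>B (y, \<rho>)\<close> is at least a multiple of \<open>s\<^sup>2\<close>.\<close>

section \<open>The Poincare-Miranda theorem on a square\<close>

text \<open>A point of the square is moved by the error of \<open>g\<close> horizontally and by that of \<open>f\<close>
  vertically, then clipped back into the square. Brouwer gives a fixed point. If clipping is active
  there, the fixed point lies on a side, and the sign condition on that side says that the error
  pointed inwards, so it vanishes all the same.\<close>

lemma poincare_miranda_square:
  fixes f g :: "real \<times> real \<Rightarrow> real"
  assumes contf: "continuous_on (cbox (-1, -1) (1, 1)) f"
    and contg: "continuous_on (cbox (-1, -1) (1, 1)) g"
    and bottom: "\<And>x. x \<in> {-1..1} \<Longrightarrow> f (x, -1) \<le> a"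
    and top: "\<And>x. x \<in> {-1..1} \<Longrightarrow> a \<le> f (x, 1)"
    and right: "\<And>y. y \<in> {-1..1} \<Longrightarrow> g (1, y) \<le> b"
    and left: "\<And>y. y \<in> {-1..1} \<Longrightarrow> b \<le> g (-1, y)"
  obtains q where "q \<in> cbox (-1, -1) (1, 1)" "f q = a" "g q = b"
proof -
  let ?Q = "cbox (-1, -1) (1, 1) :: (real \<times> real) set"
  let ?clip = "\<lambda>t::real. max (-1) (min 1 t)"
  define F where "F q = (?clip (fst q + (g q - b)), ?clip (snd q - (f q - a)))" for q
  have contF: "continuous_on ?Q F"
    unfolding F_def by (intro continuous_intros contf contg)
  have FQ: "F \<in> ?Q \<rightarrow> ?Q"
    by (auto simp: F_def cbox_Pair_eq)
  have "?Q \<noteq> {}"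
    by (auto simp: cbox_Pair_eq)
  then obtain q where q: "q \<in> ?Q" "F q = q"
    using brouwer[OF compact_cbox convex_box(1) _ contF FQ] by blast
  obtain x y where xy: "q = (x, y)" by (cases q)
  have mem: "x \<in> {-1..1}" "y \<in> {-1..1}"
    using q(1) by (auto simp: xy cbox_Pair_eq)
  have fx: "x = ?clip (x + (g (x, y) - b))" "y = ?clip (y - (f (x, y) - a))"
    using q(2) by (auto simp: F_def xy)
  have "g (x, y) = b"
    using fx(1) right[OF mem(2)] left[OF mem(2)] mem
    by (cases "x = 1"; cases "x = -1") (auto simp: max_def min_def split: if_splits)
  moreover have "f (x, y) = a"
    using fx(2) bottom[OF mem(1)] top[OF mem(1)] mem
    by (cases "y = 1"; cases "y = -1") (auto simp: max_def min_def split: if_splits)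
  ultimately show thesis
    using that q(1) xy by blast
qed

section \<open>Besicovitch's inequality\<close>

lemma mdist_self [simp]: "x \<in> mspace Z \<Longrightarrow> mdist Z x x = 0"
  by simp

definition dist_to_set :: "'a metric \<Rightarrow> 'a set \<Rightarrow> 'a \<Rightarrow> real" where
  "dist_to_set Z A x = (INF a\<in>A. mdist Z a x)"

lemma dist_to_set_le: "a \<in> A \<Longrightarrow> dist_to_set Z A x \<le> mdist Z a x"
  unfolding dist_to_set_def by (rule cINF_lower) (auto intro: bdd_belowI[where m = 0])

lemma dist_to_set_ge:
  "A \<noteq> {} \<Longrightarrow> (\<And>a. a \<in> A \<Longrightarrow> s \<le> mdist Z a x) \<Longrightarrow> s \<le> dist_to_set Z A x"
  unfolding dist_to_set_def by (rule cINF_greatest)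

lemma dist_to_set_less:
  assumes "A \<noteq> {}" "dist_to_set Z A x < s"
  obtains a where "a \<in> A" "mdist Z a x < s"
  using dist_to_set_ge[OF assms(1), of s Z x] assms(2) by force

lemma dist_to_set_zero:
  assumes "x \<in> A" "A \<subseteq> mspace Z"
  shows "dist_to_set Z A x = 0"
proof (rule antisym)
  show "dist_to_set Z A x \<le> 0"
    using dist_to_set_le[OF assms(1), of Z x] assms by (simp add: subset_iff)
  show "0 \<le> dist_to_set Z A x"
    using assms by (intro dist_to_set_ge) auto
qed

lemma dist_to_set_Lipschitz:
  assumes "A \<noteq> {}" "A \<subseteq> mspace Z" "x \<in> mspace Z" "y \<in> mspace Z"
  shows "\<bar>dist_to_set Z A x - dist_to_set Z A y\<bar> \<le> mdist Z x y"
proof -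
  have *: "dist_to_set Z A x - mdist Z x y \<le> dist_to_set Z A y"
    if "x \<in> mspace Z" "y \<in> mspace Z" for x y
  proof (rule dist_to_set_ge[OF assms(1)])
    fix a assume a: "a \<in> A"
    have "dist_to_set Z A x \<le> mdist Z a x"
      by (rule dist_to_set_le[OF a])
    also have "\<dots> \<le> mdist Z a y + mdist Z y x"
      using a assms(2) that by (intro mdist_triangle) auto
    finally show "dist_to_set Z A x - mdist Z x y \<le> mdist Z a y"
      by (simp add: mdist_commute)
  qed
  show ?thesis
    using *[OF assms(3,4)] *[OF assms(4,3)] by (simp add: abs_le_iff mdist_commute)
qed

lemma continuous_map_dist_to_set:
  assumes "A \<noteq> {}" "A \<subseteq> mspace Z"
  shows "continuous_map (mtopology_of Z) euclideanreal (dist_to_set Z A)"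
proof -
  have "Lipschitz_continuous_map Z euclidean_metric (dist_to_set Z A)"
    unfolding Lipschitz_continuous_map_def
    using dist_to_set_Lipschitz[OF assms] by (intro conjI exI[of _ 1]) (auto simp: dist_real_def)
  then show ?thesis
    using Lipschitz_continuous_imp_continuous_map by fastforce
qed

lemma mdist_le_ediam: "x \<in> A \<Longrightarrow> y \<in> A \<Longrightarrow> ennreal (mdist Z x y) \<le> ediam Z A"
  unfolding ediam_def by (meson SUP_upper2 order_refl)

lemma emeasure_lborel_square:
  assumes "0 \<le> d"
  shows "emeasure lborel (cbox (x - d, y - d) (x + d, y + d) :: (real \<times> real) set) = ennreal (4 * d\<^sup>2)"
proof -
  have "cbox (x - d, y - d) (x + d, y + d) = {x - d..x + d} \<times> {y - d..y + d}"
    by (auto simp: cbox_Pair_eq)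
  then show ?thesis
    using assms
    by (simp add: lborel_prod[symmetric] lborel.emeasure_pair_measure_Times ennreal_mult[symmetric] power2_eq_square)
qed

text \<open>The pair \<open>(f, g)\<close> maps a set of diameter \<open>d\<close> into a square of side \<open>2 d\<close>, so the area of the
  image is controlled by the sum of the squared diameters of the covering sets. Only the enclosing
  squares are measured, so that arbitrary, possibly non-measurable, covering sets are allowed.\<close>

lemma square_content_le:
  fixes C :: "nat \<Rightarrow> 'a set" and f g :: "'a \<Rightarrow> real"
  assumes f: "\<And>i x y. x \<in> C i \<Longrightarrow> y \<in> C i \<Longrightarrow> \<bar>f x - f y\<bar> \<le> mdist Z x y"
    and g: "\<And>i x y. x \<in> C i \<Longrightarrow> y \<in> C i \<Longrightarrow> \<bar>g x - g y\<bar> \<le> mdist Z x y"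
    and s: "0 \<le> s"
    and cover: "\<And>a b. 0 < a \<Longrightarrow> a < s \<Longrightarrow> 0 < b \<Longrightarrow> b < s \<Longrightarrow> \<exists>i. \<exists>x\<in>C i. f x = a \<and> g x = b"
  shows "ennreal (s\<^sup>2) \<le> (\<Sum>i. 4 * (ediam Z (C i))\<^sup>2)"
proof (cases "\<exists>i. ediam Z (C i) = \<infinity>")
  case True
  then obtain i where "ediam Z (C i) = \<infinity>" by blast
  then have "4 * (ediam Z (C i))\<^sup>2 = \<infinity>"
    by (simp add: ennreal_mult_eq_top_iff)
  moreover have "4 * (ediam Z (C i))\<^sup>2 \<le> (\<Sum>i. 4 * (ediam Z (C i))\<^sup>2)"
    using ennreal_suminf_lessD linorder_not_le by blast
  ultimately show ?thesis
    by (simp add: top_unique)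
next
  case False
  define d where "d i = enn2real (ediam Z (C i))" for i
  have d: "ennreal (d i) = ediam Z (C i)" "0 \<le> d i" for i
    using False by (auto simp: d_def less_top)
  have dle: "mdist Z x y \<le> d i" if "x \<in> C i" "y \<in> C i" for i x y
    using mdist_le_ediam[OF that, of Z] d[of i] by (metis ennreal_le_iff)
  \<comment> \<open>Empty sets \<open>C i\<close> get an arbitrary centre; they only contribute a degenerate square.\<close>
  define p where "p i = (SOME x. x \<in> C i)" for i
  define B where "B i = cbox (f (p i) - d i, g (p i) - d i) (f (p i) + d i, g (p i) + d i)" for i
  have "{0<..<s} \<times> {0<..<s} \<subseteq> (\<Union>i. B i)"
  proof (clarsimp)
    fix a b assume "0 < a" "a < s" "0 < b" "b < s"
    then obtain i x where x: "x \<in> C i" "f x = a" "g x = b"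
      using cover by meson
    have pi: "p i \<in> C i"
      unfolding p_def using x(1) by (rule someI)
    have "(a, b) \<in> B i"
      using f[OF x(1) pi] g[OF x(1) pi] dle[OF x(1) pi] x(2,3) by (auto simp: B_def cbox_Pair_eq)
    then show "\<exists>i. (a, b) \<in> B i" ..
  qed
  then have "emeasure lborel ({0<..<s} \<times> {0<..<s}) \<le> emeasure lborel (\<Union>i. B i)"
    by (intro emeasure_mono) (auto simp: B_def)
  also have "\<dots> \<le> (\<Sum>i. emeasure lborel (B i))"
    by (intro emeasure_subadditive_countably) (auto simp: B_def)
  also have "\<dots> = (\<Sum>i. 4 * (ediam Z (C i))\<^sup>2)"
  proof (intro arg_cong[where f = suminf] ext)
    fix i
    have "emeasure lborel (B i) = ennreal 4 * (ennreal (d i))\<^sup>2"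
      unfolding B_def emeasure_lborel_square[OF d(2)]
      by (simp add: ennreal_mult d(2) ennreal_power[symmetric])
    then show "emeasure lborel (B i) = 4 * (ediam Z (C i))\<^sup>2"
      by (simp add: d(1))
  qed
  also have "emeasure lborel ({0<..<s} \<times> {0<..<s}) = ennreal (s\<^sup>2)"
    using s by (simp add: lborel_prod[symmetric] lborel.emeasure_pair_measure_Times ennreal_mult[symmetric] power2_eq_square)
  finally show ?thesis .
qed

text \<open>The two coordinates are the distances to the images of the bottom and of the right side. They
  are 1-Lipschitz, vanish on their own side and are at least \<open>s\<close> on the opposite one. By
  Poincare-Miranda they take every pair of values in \<open>(0, s)\<^sup>2\<close>, so a cover of the image of the
  square has squared diameters summing to at least a multiple of \<open>s\<^sup>2\<close>. Every value in \<open>(0, s)\<^sup>2\<close> is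
  taken at a point whose distance to the bottom side is less than \<open>s\<close>; this is why only the part of
  the image near the bottom side has to be covered, and it turns the global inequality into an
  estimate for small balls.\<close>

lemma besicovitch_inequality:
  fixes Z :: "'a metric" and G :: "real \<times> real \<Rightarrow> 'a"
  assumes contG: "continuous_map (top_of_set (cbox (-1, -1) (1, 1))) (mtopology_of Z) G"
    and s: "0 \<le> s"
    and bottom_top: "\<And>x x'. x \<in> {-1..1} \<Longrightarrow> x' \<in> {-1..1} \<Longrightarrow> s \<le> mdist Z (G (x, -1)) (G (x', 1))"
    and right_left: "\<And>y y'. y \<in> {-1..1} \<Longrightarrow> y' \<in> {-1..1} \<Longrightarrow> s \<le> mdist Z (G (1, y)) (G (-1, y'))"
    and CZ: "\<And>i. C i \<subseteq> mspace Z"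
    and cover: "\<And>q x. q \<in> cbox (-1, -1) (1, 1) \<Longrightarrow> x \<in> {-1..1} \<Longrightarrow> mdist Z (G (x, -1)) (G q) < s
                  \<Longrightarrow> G q \<in> (\<Union>i::nat. C i)"
  shows "ennreal (s\<^sup>2) \<le> (\<Sum>i. 4 * (ediam Z (C i))\<^sup>2)"
proof -
  let ?Q = "cbox (-1, -1) (1, 1) :: (real \<times> real) set"
  define A where "A = (\<lambda>x. G (x, -1)) ` {-1..1}"
  define B where "B = (\<lambda>y. G (1, y)) ` {-1..1}"
  have GQ: "G q \<in> mspace Z" if "q \<in> ?Q" for q
    using continuous_map_image_subset_topspace[OF contG] that by auto
  have A: "A \<noteq> {}" "A \<subseteq> mspace Z" and B: "B \<noteq> {}" "B \<subseteq> mspace Z"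
    using GQ by (auto simp: A_def B_def cbox_Pair_eq)
  have cont: "continuous_on ?Q (\<lambda>q. dist_to_set Z X (G q))" if "X \<noteq> {}" "X \<subseteq> mspace Z" for X
    using continuous_map_compose[OF contG continuous_map_dist_to_set[OF that]] by (simp add: o_def)
  show ?thesis
  proof (rule square_content_le[where f = "dist_to_set Z A" and g = "dist_to_set Z B"])
    show "\<bar>dist_to_set Z A x - dist_to_set Z A y\<bar> \<le> mdist Z x y" if "x \<in> C i" "y \<in> C i" for i x y
      using CZ[of i] that by (intro dist_to_set_Lipschitz A) auto
    show "\<bar>dist_to_set Z B x - dist_to_set Z B y\<bar> \<le> mdist Z x y" if "x \<in> C i" "y \<in> C i" for i x y
      using CZ[of i] that by (intro dist_to_set_Lipschitz B) auto
    fix a b :: real assume ab: "0 < a" "a < s" "0 < b" "b < s"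
    obtain q where q: "q \<in> ?Q" "dist_to_set Z A (G q) = a" "dist_to_set Z B (G q) = b"
    proof (rule poincare_miranda_square[OF cont[OF A] cont[OF B], of a b])
      show "dist_to_set Z A (G (x, -1)) \<le> a" if "x \<in> {-1..1}" for x
        using dist_to_set_zero[of "G (x, -1)" A Z] A that ab by (auto simp: A_def)
      show "a \<le> dist_to_set Z A (G (x, 1))" if "x \<in> {-1..1}" for x
        using order_trans[OF less_imp_le[OF ab(2)] bottom_top[OF _ that]]
        by (intro dist_to_set_ge A) (auto simp: A_def)
      show "dist_to_set Z B (G (1, y)) \<le> b" if "y \<in> {-1..1}" for y
        using dist_to_set_zero[of "G (1, y)" B Z] B that ab by (auto simp: B_def)
      show "b \<le> dist_to_set Z B (G (-1, y))" if "y \<in> {-1..1}" for y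
        using order_trans[OF less_imp_le[OF ab(4)] right_left[OF _ that]]
        by (intro dist_to_set_ge B) (auto simp: B_def)
    qed
    obtain x where "x \<in> {-1..1}" "mdist Z (G (x, -1)) (G q) < s"
      using dist_to_set_less[OF A(1)] q(2) ab(2) by (force simp: A_def)
    then show "\<exists>i. \<exists>x\<in>C i. dist_to_set Z A x = a \<and> dist_to_set Z B x = b"
      using cover[OF q(1)] q(2,3) by blast
  qed (rule s)
qed

section \<open>Points and arcs on the unit circle\<close>

definition circle_point :: "real \<Rightarrow> real ^ 2" where
  "circle_point t = vector [cos t, sin t]"

lemma dist_circle_point: "dist (circle_point a) (circle_point b) = 2 * \<bar>sin ((a - b) / 2)\<bar>"
proof -
  have "(dist (circle_point a) (circle_point b))\<^sup>2 = (cos a - cos b)\<^sup>2 + (sin a - sin b)\<^sup>2"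
    by (simp add: circle_point_def dist_vec_def L2_set_def UNIV_2 dist_real_def)
  also have "\<dots> = 2 - 2 * cos (a - b)"
    using sin_cos_squared_add[of a] sin_cos_squared_add[of b]
    by (simp add: cos_diff power2_diff algebra_simps)
  also have "cos (a - b) = 1 - 2 * (sin ((a - b) / 2))\<^sup>2"
    using cos_double_sin[of "(a - b) / 2"] by (simp only: mult_2 field_sum_of_halves)
  also have "2 - 2 * (1 - 2 * (sin ((a - b) / 2))\<^sup>2) = (2 * \<bar>sin ((a - b) / 2)\<bar>)\<^sup>2"
    by (simp add: power_mult_distrib)
  finally show ?thesis
    by (rule power2_eq_imp_eq) auto
qed

lemma norm_circle_point [simp]: "norm (circle_point t) = 1"
  by (simp add: circle_point_def norm_vec_def L2_set_def UNIV_2)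

lemma circle_point_periodic: "circle_point (t + 2 * pi) = circle_point t"
  by (simp add: circle_point_def)

lemma circle_point_exhaust:
  assumes "norm z = 1"
  obtains t where "z = circle_point t"
proof -
  have "(z $ 1)\<^sup>2 + (z $ 2)\<^sup>2 = 1"
    using assms by (simp add: norm_vec_def L2_set_def UNIV_2)
  then obtain t where "z $ 1 = cos t" "z $ 2 = sin t"
    using sincos_total_2pi by metis
  then have "z = circle_point t"
    by (simp add: circle_point_def vec_eq_iff forall_2)
  then show thesis by (rule that)
qed

lemma continuous_on_circle_point [continuous_intros]:
  fixes f :: "'a::t2_space \<Rightarrow> real"
  assumes f: "continuous_on S f"
  shows "continuous_on S (\<lambda>x. circle_point (f x))"
proof -
  have "(\<lambda>x. circle_point (f x)) = (\<lambda>x. \<chi> i. if i = 1 then cos (f x) else sin (f x))"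
    by (simp add: fun_eq_iff circle_point_def vec_eq_iff forall_2)
  moreover have "continuous_on S (\<lambda>x. \<chi> i::2. if i = 1 then cos (f x) else sin (f x))"
  proof (intro continuous_on_vec_lambda)
    fix i :: 2
    show "continuous_on S (\<lambda>x. if i = 1 then cos (f x) else sin (f x))"
      using continuous_on_cos[OF f] continuous_on_sin[OF f] by (cases "i = 1") simp_all
  qed
  ultimately show ?thesis
    by (simp only:)
qed

lemma dist_circle_point_le: "dist (circle_point a) (circle_point b) \<le> \<bar>a - b\<bar>"
  using abs_sin_x_le_abs_x[of "(a - b) / 2"] by (simp add: dist_circle_point)

text \<open>The chord length increases up to a half turn and is symmetric about it, so that the extreme
  angle \<open>\<alpha>\<close> gives the shortest chord. There the sine is compared with its third-order Taylor bound.\<close>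

lemma dist_circle_point_ge:
  assumes "0 < \<alpha>" "\<alpha> \<le> 1 / 2" "\<alpha> \<le> b - a" "b - a \<le> 2 * pi - \<alpha>"
  shows "\<alpha> / 2 \<le> dist (circle_point a) (circle_point b)"
proof -
  define x where "x = \<alpha> / 2"
  have x: "0 < x" "x \<le> 1 / 4"
    using assms by (auto simp: x_def)
  have "\<bar>sin x - x\<bar> \<le> x ^ 3 / 6"
    using Maclaurin_sin_bound[of x 3] x
    by (simp add: sin_coeff_def lessThan_Suc numeral_3_eq_3 fact_numeral divide_simps)
  moreover have "x ^ 3 \<le> x * 1"
    unfolding power3_eq_cube using x by (simp add: mult.assoc mult_le_one)
  ultimately have "x / 2 \<le> sin x"
    using x by (simp only: abs_le_iff) linarith
  also have "sin x \<le> sin ((b - a) / 2)"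
  proof (cases "(b - a) / 2 \<le> pi / 2")
    case True
    then show ?thesis
      using assms x by (intro sin_monotone_2pi_le) (auto simp: x_def)
  next
    case False
    have "sin x \<le> sin (pi - (b - a) / 2)"
      using False assms x by (intro sin_monotone_2pi_le) (auto simp: x_def field_simps)
    then show ?thesis by simp
  qed
  also have "\<dots> \<le> \<bar>sin ((a - b) / 2)\<bar>"
    by (metis abs_ge_self abs_minus_cancel minus_diff_eq minus_divide_left sin_minus)
  finally show ?thesis
    by (simp add: dist_circle_point x_def)
qed

section \<open>Weak quasisymmetry\<close>

text \<open>Apply the distortion inequality with the radii \<open>r1 = dist u w\<close> and \<open>r2 = r1 / K\<close>. Their ratio is
  exactly \<open>K\<close>, so the single value \<open>\<eta> K\<close> serves for all triples. The inequality requires \<open>r1 < 2\<close>, which excludes only the case that \<open>w\<close> is antipodal to \<open>u\<close>;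
  then one goes from \<open>u\<close> to \<open>w\<close> in two steps through the midpoint of a half circle, at the price of
  the constant \<open>\<eta> K + (\<eta> K)\<^sup>2\<close>.\<close>

lemma quasisymmetric_circle_imp_weakly_quasisymmetric:
  assumes qs: "quasisymmetric unit_circle W g" and K: "1 \<le> K"
  obtains H where "1 \<le> H"
    "\<And>u v w. \<lbrakk>norm u = 1; norm v = 1; norm w = 1; dist u w \<le> K * dist u v\<rbrakk>
       \<Longrightarrow> mdist W (g u) (g w) \<le> H * mdist W (g u) (g v)"
proof -
  obtain \<eta> where hom: "homeomorphic_map (mtopology_of unit_circle) (mtopology_of W) g"
    and hometa: "homeomorphic_map (top_of_set {0..}) (top_of_set {0::real..}) \<eta>"
    and eta: "\<And>z r1 r2. \<lbrakk>z \<in> mspace unit_circle; 0 < r1; ennreal r1 < ediam unit_circle (mspace unit_circle);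
         0 < r2; ennreal r2 < ediam unit_circle (mspace unit_circle)\<rbrakk> \<Longrightarrow>
           (SUP w \<in> mcball_of unit_circle z r1. ennreal (mdist W (g z) (g w)))
             \<le> ennreal (\<eta> (r1 / r2)) *
               (INF w \<in> mspace unit_circle - mball_of unit_circle z r2. ennreal (mdist W (g z) (g w)))"
    using qs unfolding quasisymmetric_def by blast
  have gW: "g u \<in> mspace W" if "norm u = 1" for u
    using homeomorphic_imp_surjective_map[OF hom] that
    by (auto simp: mtopology_of_submetric set_eq_iff)
  define E where "E = \<eta> K"
  have E: "0 \<le> E"
    using homeomorphic_imp_surjective_map[OF hometa] K by (force simp: E_def)
  have diam: "ennreal r < ediam unit_circle (mspace unit_circle)" if "0 < r" "r < 2" for r
  proof -
    have "ennreal r < ennreal (mdist unit_circle (circle_point 0) (circle_point pi))"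
      using that by (simp add: dist_circle_point ennreal_less_iff)
    also have "\<dots> \<le> ediam unit_circle (mspace unit_circle)"
      by (rule mdist_le_ediam) auto
    finally show ?thesis .
  qed
  have near: "mdist W (g u) (g w) \<le> E * mdist W (g u) (g v)"
    if n: "norm u = 1" "norm v = 1" "norm w = 1" and uw: "dist u w \<le> K * dist u v" "dist u w < 2" for u v w
  proof (cases "u = w")
    case True
    then show ?thesis
      using E gW[OF n(1)] by simp
  next
    case False
    define r1 where "r1 = dist u w"
    define r2 where "r2 = r1 / K"
    have r1: "0 < r1" "r1 < 2"
      using False uw by (auto simp: r1_def)
    have r2: "0 < r2" "r2 \<le> r1" "r2 \<le> dist u v" "r1 / r2 = K"
    proof -
      show "0 < r2" "r1 / r2 = K"
        using r1 K by (simp_all add: r2_def)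
      show "r2 \<le> r1"
        using r1 K mult_left_mono[of 1 K r1] by (simp add: r2_def divide_le_eq)
      show "r2 \<le> dist u v"
        using uw(1) K by (simp add: r2_def r1_def divide_le_eq mult.commute)
    qed
    have "ennreal (mdist W (g u) (g w)) \<le> (SUP w \<in> mcball_of unit_circle u r1. ennreal (mdist W (g u) (g w)))"
      by (rule SUP_upper) (use n in \<open>auto simp: r1_def\<close>)
    also have "\<dots> \<le> ennreal (\<eta> (r1 / r2)) *
        (INF w \<in> mspace unit_circle - mball_of unit_circle u r2. ennreal (mdist W (g u) (g w)))"
      by (rule eta) (use n r1 r2 diam in \<open>simp_all\<close>)
    also have "\<dots> \<le> ennreal E * ennreal (mdist W (g u) (g v))"
      unfolding r2(4) E_def by (intro mult_left_mono INF_lower) (use n r2 in auto)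
    finally show ?thesis
      using E by (simp add: ennreal_mult[symmetric])
  qed
  show thesis
  proof (rule that[of "1 + E + E * E"])
    show "1 \<le> 1 + E + E * E"
      using E by simp
    fix u v w :: "real ^ 2"
    assume n: "norm u = 1" "norm v = 1" "norm w = 1" and uw: "dist u w \<le> K * dist u v"
    have "mdist W (g u) (g w) \<le> (E + E * E) * mdist W (g u) (g v)"
    proof (cases "dist u w < 2")
      case True
      have "E * mdist W (g u) (g v) \<le> (E + E * E) * mdist W (g u) (g v)"
        using E by (intro mult_right_mono) auto
      then show ?thesis
        using near[OF n uw True] by linarith
    next
      case False
      obtain t where t: "u = circle_point t"
        using circle_point_exhaust[OF n(1)] .
      \<comment> \<open>The intermediate point has the same distance \<open>sqrt 2 < 2\<close> to \<open>u\<close> and to its antipode \<open>w\<close>.\<close>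
      define p where "p = circle_point (t + pi / 2)"
      have "norm (u + w) = 0"
      proof -
        have "(norm (u + w))\<^sup>2 + (norm (u - w))\<^sup>2 = 4"
          using n dot_square_norm[of u] dot_square_norm[of w]
          by (simp add: power2_norm_eq_inner inner_add_left inner_add_right inner_diff_left inner_diff_right)
        moreover have "4 \<le> (norm (u - w))\<^sup>2"
          using power_mono[of 2 "norm (u - w)" 2] False by (simp add: dist_norm)
        ultimately show ?thesis
          by (smt (verit) power2_less_eq_zero_iff zero_le_power2)
      qed
      then have "w = - u"
        by (simp add: add_eq_0_iff)
      then have w: "w = circle_point (t + pi)"
        by (simp add: t circle_point_def vec_eq_iff forall_2)
      have up: "dist u p = sqrt 2" and pw: "dist p w = sqrt 2"
        by (simp_all add: t w p_def dist_circle_point sin_45)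
      have np: "norm p = 1"
        by (simp add: p_def)
      have sq2: "sqrt 2 < 2"
        by (simp add: real_less_lsqrt)
      have 1: "mdist W (g u) (g p) \<le> E * mdist W (g u) (g v)"
        by (rule near) (use n np up sq2 uw False in auto)
      have "mdist W (g p) (g w) \<le> E * mdist W (g p) (g u)"
        by (rule near) (use n np up pw sq2 K in \<open>auto simp: dist_commute\<close>)
      also have "\<dots> \<le> E * (E * mdist W (g u) (g v))"
        using 1 E by (intro mult_left_mono) (auto simp: mdist_commute)
      finally show ?thesis
        using 1 mdist_triangle[of "g u" W "g p" "g w"] gW n np by (simp add: algebra_simps)
    qed
    also have "\<dots> \<le> (1 + E + E * E) * mdist W (g u) (g v)"
      by (intro mult_right_mono) auto
    finally show "mdist W (g u) (g w) \<le> (1 + E + E * E) * mdist W (g u) (g v)" .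
  qed
qed

section \<open>Wrapping the boundary of the square around the circle\<close>

definition square_sides :: "(real \<times> real) set" where
  "square_sides = {-1..1} \<times> {1} \<union> ({-1..1} \<times> {-1} \<union> {-1, 1} \<times> {-1..1})"

text \<open>A loop that runs once around the circle. The bottom side covers the arc of half-angle \<open>\<alpha>\<close>
  centred at angle \<open>\<theta>\<close>, the vertical sides cover the two adjacent arcs of length \<open>\<alpha>\<close>, and the top
  side covers everything that remains. Winding once around is forced by the requirement that
  opposite sides stay apart.\<close>

definition circle_loop :: "real \<Rightarrow> real \<Rightarrow> real \<times> real \<Rightarrow> real ^ 2" where
  "circle_loop \<theta> \<alpha> q = circle_point
     (if snd q = 1 then \<theta> + pi - fst q * (pi - 2 * \<alpha>) else \<theta> + fst q * \<alpha> * (3 + snd q) / 2)"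

lemma norm_circle_loop [simp]: "norm (circle_loop \<theta> \<alpha> q) = 1"
  by (simp add: circle_loop_def)

lemma continuous_on_circle_loop: "continuous_on square_sides (circle_loop \<theta> \<alpha>)"
proof -
  have "continuous_on square_sides (\<lambda>q. if snd q = 1
      then circle_point (\<theta> + pi - fst q * (pi - 2 * \<alpha>))
      else circle_point (\<theta> + fst q * \<alpha> * (3 + snd q) / 2))"
    unfolding square_sides_def
  proof (rule continuous_on_If)
    fix q :: "real \<times> real"
    assume "q \<in> {-1..1} \<times> {-1} \<union> {-1, 1} \<times> {-1..1}" "snd q = 1"
    then have "q = (1, 1) \<or> q = (-1, 1)"
      by (cases q) auto
    then show "circle_point (\<theta> + pi - fst q * (pi - 2 * \<alpha>))
        = circle_point (\<theta> + fst q * \<alpha> * (3 + snd q) / 2)"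
    proof
      assume "q = (1, 1)"
      then show ?thesis by simp
    next
      assume q: "q = (-1, 1)"
      have "circle_point (\<theta> + pi + (pi - 2 * \<alpha>)) = circle_point (\<theta> - 2 * \<alpha>)"
        using circle_point_periodic[of "\<theta> - 2 * \<alpha>"] by (simp add: add.commute add.left_commute)
      then show ?thesis
        by (simp add: q)
    qed
  qed (auto intro!: closed_Times closed_Un continuous_intros)
  then show ?thesis
    by (simp add: circle_loop_def[abs_def] if_distrib)
qed

lemma circle_loop_bottom_near:
  assumes "x \<in> {-1..1}" "0 < \<alpha>"
  shows "dist (circle_loop \<theta> \<alpha> (x, -1)) (circle_point \<theta>) \<le> \<alpha>"
proof -
  have "\<bar>x * \<alpha>\<bar> \<le> 1 * \<alpha>"
    unfolding abs_mult using assms by (intro mult_mono) auto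
  then show ?thesis
    using dist_circle_point_le[of "\<theta> + x * \<alpha>" \<theta>] by (simp add: circle_loop_def)
qed

lemma circle_loop_right_near:
  assumes "y \<in> {-1..1}" "0 < \<alpha>" "\<alpha> \<le> 1 / 2"
  shows "dist (circle_loop \<theta> \<alpha> (1, y)) (circle_point \<theta>) \<le> 2 * \<alpha>"
proof (cases "y = 1")
  case True
  then show ?thesis
    using dist_circle_point_le[of "\<theta> + 2 * \<alpha>" \<theta>] assms by (simp add: circle_loop_def)
next
  case False
  have bounds: "\<alpha> * (3 + y) \<le> \<alpha> * 4" "0 \<le> \<alpha> * (3 + y)"
    using assms by auto
  have "dist (circle_loop \<theta> \<alpha> (1, y)) (circle_point \<theta>) \<le> \<bar>\<alpha> * (3 + y) / 2\<bar>"
    using dist_circle_point_le[of "\<theta> + \<alpha> * (3 + y) / 2" \<theta>] False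
    by (simp add: circle_loop_def)
  then show ?thesis
    using bounds by linarith
qed

lemma circle_loop_bottom_top:
  assumes x: "x \<in> {-1..1}" "x' \<in> {-1..1}" and \<alpha>: "0 < \<alpha>" "\<alpha> \<le> 1 / 2"
  shows "\<alpha> / 2 \<le> dist (circle_loop \<theta> \<alpha> (x, -1)) (circle_loop \<theta> \<alpha> (x', 1))"
proof -
  have "\<bar>x * \<alpha>\<bar> \<le> 1 * \<alpha>"
    unfolding abs_mult using x \<alpha> by (intro mult_mono) auto
  moreover have "\<bar>x' * (pi - 2 * \<alpha>)\<bar> \<le> 1 * (pi - 2 * \<alpha>)"
    unfolding abs_mult using x \<alpha> pi_gt3 by (intro mult_mono) auto
  ultimately show ?thesis
    using dist_circle_point_ge[OF \<alpha>, where a = "\<theta> + x * \<alpha>" and b = "\<theta> + pi - x' * (pi - 2 * \<alpha>)"]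
    unfolding circle_loop_def abs_le_iff by simp
qed

lemma circle_loop_right_side: "circle_loop \<theta> \<alpha> (1, y) = circle_point (\<theta> + \<alpha> * (3 + y) / 2)"
  by (simp add: circle_loop_def)

lemma circle_loop_left_side: "circle_loop \<theta> \<alpha> (-1, y) = circle_point (\<theta> - \<alpha> * (3 + y) / 2)"
proof -
  have "\<theta> + pi + (pi - 2 * \<alpha>) = (\<theta> - \<alpha> * (3 + 1) / 2) + 2 * pi"
    by simp
  then have "circle_point (\<theta> + pi + (pi - 2 * \<alpha>)) = circle_point (\<theta> - \<alpha> * (3 + 1) / 2)"
    by (simp only: circle_point_periodic)
  then show ?thesis
    by (simp add: circle_loop_def)
qed

lemma circle_loop_right_left:
  assumes y: "y \<in> {-1..1}" "y' \<in> {-1..1}" and \<alpha>: "0 < \<alpha>" "\<alpha> \<le> 1 / 2"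
  shows "\<alpha> / 2 \<le> dist (circle_loop \<theta> \<alpha> (1, y)) (circle_loop \<theta> \<alpha> (-1, y'))"
proof -
  have "\<alpha> * 2 \<le> \<alpha> * (3 + y)" "\<alpha> * 2 \<le> \<alpha> * (3 + y')" "\<alpha> * (3 + y) \<le> \<alpha> * 4" "\<alpha> * (3 + y') \<le> \<alpha> * 4"
    using y \<alpha> by auto
  then show ?thesis
    using dist_circle_point_ge[OF \<alpha>, where a = "\<theta> - \<alpha> * (3 + y') / 2" and b = "\<theta> + \<alpha> * (3 + y) / 2"] \<alpha> pi_gt3
    unfolding circle_loop_right_side circle_loop_left_side
    by (subst dist_commute) linarith
qed

text \<open>A homeomorph of a convex set is an absolute extensor: extend in the convex model with
  Dugundji's theorem.\<close>

lemma convex_homeomorph_extension: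
  fixes D :: "'c::real_inner set" and U :: "'d::{metric_space,second_countable_topology} set"
  assumes hom: "X homeomorphic_space top_of_set D" and D: "convex D" "D \<noteq> {}"
    and clo: "closedin (top_of_set U) T"
    and f: "continuous_map (top_of_set T) X f"
  obtains F where "continuous_map (top_of_set U) X F" "\<And>x. x \<in> T \<Longrightarrow> F x = f x"
proof -
  obtain h k where hk: "continuous_map X (top_of_set D) h" "continuous_map (top_of_set D) X k"
    "\<And>x. x \<in> topspace X \<Longrightarrow> k (h x) = x"
    using hom unfolding homeomorphic_space_def homeomorphic_maps_def by blast
  have "continuous_map (top_of_set T) (top_of_set D) (h \<circ> f)"
    by (rule continuous_map_compose[OF f hk(1)])
  then have "continuous_on T (h \<circ> f)" "(h \<circ> f) ` T \<subseteq> D"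
    by (auto simp: continuous_map_in_subtopology)
  then obtain g where g: "continuous_on U g" "g ` U \<subseteq> D" "\<And>x. x \<in> T \<Longrightarrow> g x = (h \<circ> f) x"
    using Dugundji[OF D clo] by metis
  show thesis
  proof
    show "continuous_map (top_of_set U) X (k \<circ> g)"
      by (rule continuous_map_compose[OF _ hk(2)]) (use g in \<open>auto simp: continuous_map_in_subtopology\<close>)
    show "(k \<circ> g) x = f x" if "x \<in> T" for x
      using g(3)[OF that] hk(3) continuous_map_image_subset_topspace[OF f] that by auto
  qed
qed

section \<open>Lower area bound at the boundary\<close>

text \<open>Let \<open>t\<close> be the distance from \<open>z\<close>, where \<open>y = g z\<close>, to the nearest point of the circle whose
  image is at distance at least \<open>\<rho> / 4\<close> from \<open>y\<close>. Then \<open>g\<close> maps the open arc of chordal radius \<open>t\<close> close to \<open>y\<close>,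
  while weak quasisymmetry shows that points near \<open>z\<close> at mutual distance at least \<open>t / 8\<close> have
  images at distance at least a multiple of \<open>\<rho>\<close>. Hence the four arcs of \<open>circle_loop\<close> at scale \<open>t\<close> are mapped to
  the sides of a quadrilateral whose opposite sides are at distance at least a multiple of \<open>\<rho>\<close>, and
  whose bottom side lies near \<open>y\<close>. As \<open>Z\<close> is a disk, the quadrilateral can be filled in, and
  Besicovitch's inequality applies to the filling. The bound is stated for covers by sets of
  arbitrary diameter, which is stronger than a bound on the Hausdorff measure.\<close>

lemma quasicircle_boundary_content_lower_bound:
  fixes Z :: "'a metric"
  assumes homZ: "mtopology_of Z homeomorphic_space mtopology_of closed_unit_disk"
    and PZ: "P \<subseteq> mspace Z"
    and qs: "quasisymmetric unit_circle (submetric Z P) g"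
  obtains c where "0 < c"
    "\<And>y \<rho> C. \<lbrakk>y \<in> P; 0 < \<rho>; ennreal \<rho> < ediam Z P; \<And>i::nat. C i \<subseteq> mspace Z; mball_of Z y \<rho> \<subseteq> (\<Union>i. C i)\<rbrakk>
       \<Longrightarrow> ennreal (c * \<rho>\<^sup>2) \<le> (\<Sum>i. 4 * (ediam Z (C i))\<^sup>2)"
proof -
  let ?Q = "cbox (-1, -1) (1, 1) :: (real \<times> real) set"
  have homg: "homeomorphic_map (mtopology_of unit_circle) (mtopology_of (submetric Z P)) g"
    using qs unfolding quasisymmetric_def by blast
  have gP: "g ` sphere 0 1 = P"
    using homeomorphic_imp_surjective_map[OF homg] PZ
    by (simp add: mtopology_of_submetric Int_absorb1)
  have gZ: "g u \<in> mspace Z" if "norm u = 1" for u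
    using gP PZ that by auto
  have contg: "continuous_map (top_of_set (sphere 0 1)) (mtopology_of Z) g"
    using homeomorphic_imp_continuous_map[OF homg]
    by (simp add: mtopology_of_submetric continuous_map_in_subtopology)
  obtain H where H: "1 \<le> H"
    "\<And>u v w. \<lbrakk>norm u = 1; norm v = 1; norm w = 1; dist u w \<le> 16 * dist u v\<rbrakk>
       \<Longrightarrow> mdist Z (g u) (g w) \<le> H * mdist Z (g u) (g v)"
    using quasisymmetric_circle_imp_weakly_quasisymmetric[OF qs, of 16] by auto
  show thesis
  proof (rule that[of "1 / (64 * H\<^sup>2)"])
    show "0 < 1 / (64 * H\<^sup>2)"
      using H(1) by simp
    fix y \<rho> and C :: "nat \<Rightarrow> 'a set"
    assume y: "y \<in> P" and \<rho>: "0 < \<rho>" "ennreal \<rho> < ediam Z P"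
      and CZ: "\<And>i. C i \<subseteq> mspace Z" and cover: "mball_of Z y \<rho> \<subseteq> (\<Union>i. C i)"
    obtain z where z: "norm z = 1" "y = g z"
      using y gP by auto
    \<comment> \<open>If \<open>T\<close> were empty, \<open>P\<close> would lie within distance \<open>\<rho> / 4\<close> of \<open>y\<close>, against \<open>\<rho> < ediam Z P\<close>.\<close>
    define T where "T = {w \<in> sphere 0 1. \<rho> / 4 \<le> mdist Z y (g w)}"
    have "T \<noteq> {}"
    proof
      assume "T = {}"
      then have close: "mdist Z y b \<le> \<rho> / 4" if "b \<in> P" for b
        using that gP by (force simp: T_def)
      have "ediam Z P \<le> ennreal \<rho>"
        unfolding ediam_def
      proof (intro SUP_least ennreal_leI)
        fix a b assume ab: "a \<in> P" "b \<in> P"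
        then have "mdist Z a b \<le> mdist Z a y + mdist Z y b"
          using PZ y by (intro mdist_triangle) auto
        then show "mdist Z a b \<le> \<rho>"
          using close[OF ab(1)] close[OF ab(2)] \<rho>(1) by (simp add: mdist_commute)
      qed
      then show False
        using \<rho>(2) by simp
    qed
    have "continuous_map (top_of_set (sphere 0 1)) euclideanreal (dist_to_set Z {y} \<circ> g)"
      using gZ z by (intro continuous_map_compose[OF contg] continuous_map_dist_to_set) auto
    then have "continuous_on (sphere 0 1) (\<lambda>w. mdist Z y (g w))"
      by (simp add: o_def dist_to_set_def)
    then have "closed (sphere 0 1 \<inter> (\<lambda>w. mdist Z y (g w)) -` {\<rho> / 4..})"
      by (intro continuous_closed_preimage) auto
    moreover have "T = sphere 0 1 \<inter> (\<lambda>w. mdist Z y (g w)) -` {\<rho> / 4..}"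
      by (auto simp: T_def)
    ultimately have "closed T"
      by simp
    then have "compact T"
      using compact_Int_closed[of "sphere 0 1" T] by (simp add: T_def Int_def)
    moreover have "continuous_on T (\<lambda>w. dist z w)"
      by (intro continuous_intros)
    ultimately obtain w0 where w0: "w0 \<in> T" "\<And>w. w \<in> T \<Longrightarrow> dist z w0 \<le> dist z w"
      using continuous_attains_inf[OF _ \<open>T \<noteq> {}\<close>] by blast
    define t where "t = dist z w0"
    have nw0: "norm w0 = 1" "\<rho> / 4 \<le> mdist Z y (g w0)"
      using w0(1) by (auto simp: T_def)
    have "w0 \<noteq> z"
      using nw0 z gZ \<rho> by auto
    then have t: "0 < t" "t \<le> 2"
      using norm_triangle_ineq4[of z w0] z nw0 by (auto simp: t_def dist_norm)
    have near: "mdist Z y (g w) < \<rho> / 4" if "norm w = 1" "dist z w < t" for w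
      using w0(2)[of w] that by (force simp: T_def t_def)
    define s where "s = \<rho> / (8 * H)"
    have s: "0 < s" "s \<le> \<rho> / 8"
      using \<rho>(1) H(1) mult_left_mono[OF H(1), of \<rho>] by (auto simp: s_def divide_simps)
    \<comment> \<open>Of the two points \<open>z\<close> and \<open>w0\<close>, whose images are \<open>\<rho> / 4\<close> apart, one has an image at distance at
      least \<open>\<rho> / 8\<close> from \<open>g u\<close>; both lie within \<open>2 * t\<close> of \<open>u\<close>, hence the ratio 16 in the choice of \<open>H\<close>.\<close>
    have far: "s \<le> mdist Z (g u) (g v)"
      if n: "norm u = 1" "norm v = 1" and u: "dist u z \<le> t" and uv: "t / 8 \<le> dist u v" for u v
    proof -
      have "mdist Z (g u) (g z) \<le> H * mdist Z (g u) (g v)"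
        by (rule H(2)) (use n z u uv t in auto)
      moreover have "mdist Z (g u) (g w0) \<le> H * mdist Z (g u) (g v)"
      proof (rule H(2))
        have "dist u w0 \<le> 2 * t"
          using dist_triangle[of u w0 z] u by (simp add: t_def)
        then show "dist u w0 \<le> 16 * dist u v"
          using uv by simp
      qed (use n nw0 in auto)
      moreover have "mdist Z y (g w0) \<le> mdist Z y (g u) + mdist Z (g u) (g w0)"
        by (rule mdist_triangle) (use n nw0 z gZ in auto)
      ultimately have "\<rho> / 4 \<le> 2 * (H * mdist Z (g u) (g v))"
        using nw0(2) z(2) by (simp add: mdist_commute)
      then show ?thesis
        using H(1) by (simp add: s_def field_simps)
    qed
    obtain \<theta> where \<theta>: "z = circle_point \<theta>"
      using circle_point_exhaust[OF z(1)] .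
    \<comment> \<open>With \<open>\<alpha> = t / 4\<close> the bottom and right sides of the loop stay within \<open>t\<close> of \<open>z\<close>, and opposite
      sides are \<open>\<alpha> / 2 = t / 8\<close> apart, as \<open>far\<close> requires.\<close>
    define \<alpha> where "\<alpha> = t / 4"
    have \<alpha>: "0 < \<alpha>" "\<alpha> \<le> 1 / 2"
      using t by (auto simp: \<alpha>_def)
    let ?b = "circle_loop \<theta> \<alpha>"
    have "continuous_map (top_of_set square_sides) (top_of_set (sphere 0 1)) ?b"
      using continuous_on_circle_loop by (auto simp: continuous_map_in_subtopology)
    then have "continuous_map (top_of_set square_sides) (mtopology_of Z) (g \<circ> ?b)"
      by (rule continuous_map_compose[OF _ contg])
    moreover have "closedin (top_of_set ?Q) square_sides"
      by (rule closed_subset)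
        (auto simp: square_sides_def cbox_Pair_eq intro!: closed_Times closed_Un)
    moreover have "mtopology_of Z homeomorphic_space top_of_set (cball (0 :: real ^ 2) 1)"
      using homZ by (simp add: mtopology_of_submetric)
    ultimately obtain G where G: "continuous_map (top_of_set ?Q) (mtopology_of Z) G"
      "\<And>q. q \<in> square_sides \<Longrightarrow> G q = g (?b q)"
      using convex_homeomorph_extension[of "mtopology_of Z" "cball (0 :: real ^ 2) 1" ?Q square_sides "g \<circ> ?b"]
      by auto
    have sides: "G (x, -1) = g (?b (x, -1))" "G (x, 1) = g (?b (x, 1))"
      "G (1, x) = g (?b (1, x))" "G (-1, x) = g (?b (-1, x))" if "x \<in> {-1..1}" for x
      using that by (auto intro!: G(2) simp: square_sides_def)
    have "ennreal (s\<^sup>2) \<le> (\<Sum>i. 4 * (ediam Z (C i))\<^sup>2)"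
    proof (rule besicovitch_inequality[OF G(1) _ _ _ CZ])
      show "s \<le> mdist Z (G (x, -1)) (G (x', 1))" if "x \<in> {-1..1}" "x' \<in> {-1..1}" for x x'
        unfolding sides[OF that(1)] sides[OF that(2)]
        using circle_loop_bottom_near[OF that(1) \<alpha>(1), of \<theta>] circle_loop_bottom_top[OF that \<alpha>, of \<theta>] t
        by (intro far) (auto simp: \<theta> \<alpha>_def)
      show "s \<le> mdist Z (G (1, x)) (G (-1, x'))" if "x \<in> {-1..1}" "x' \<in> {-1..1}" for x x'
        unfolding sides[OF that(1)] sides[OF that(2)]
        using circle_loop_right_near[OF that(1) \<alpha>, of \<theta>] circle_loop_right_left[OF that \<alpha>, of \<theta>] t
        by (intro far) (auto simp: \<theta> \<alpha>_def)
      fix q x assume q: "q \<in> ?Q" and x: "x \<in> {-1..1}" and lt: "mdist Z (G (x, -1)) (G q) < s"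
      have mem: "G q \<in> mspace Z" "G (x, -1) \<in> mspace Z" "y \<in> mspace Z"
        using continuous_map_image_subset_topspace[OF G(1)] q x y PZ by (auto simp: cbox_Pair_eq)
      have "mdist Z y (G (x, -1)) < \<rho> / 4"
        unfolding sides[OF x]
        using circle_loop_bottom_near[OF x \<alpha>(1), of \<theta>] t
        by (intro near) (auto simp: \<theta> \<alpha>_def dist_commute)
      then have "mdist Z y (G q) < \<rho>"
        using mdist_triangle[OF mem(3,2,1)] lt s \<rho>(1) by linarith
      then show "G q \<in> (\<Union>i. C i)"
        using cover mem by auto
    qed (use s in auto)
    moreover have "s\<^sup>2 = 1 / (64 * H\<^sup>2) * \<rho>\<^sup>2"
      by (simp add: s_def power_divide power_mult_distrib)
    ultimately show "ennreal (1 / (64 * H\<^sup>2) * \<rho>\<^sup>2) \<le> (\<Sum>i. 4 * (ediam Z (C i))\<^sup>2)"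
      by simp
  qed
qed

section \<open>Counting separated boundary points\<close>

lemma ediam_empty [simp]: "ediam Z {} = 0"
  by (simp add: ediam_def bot_ennreal)

lemma hausdorff2_mono: "A \<subseteq> B \<Longrightarrow> hausdorff2 Z A \<le> hausdorff2 Z B"
  unfolding hausdorff2_def hausdorff2_premeasure_def
  by (intro SUP_mono' INF_superset_mono) auto

text \<open>Superadditivity of the Hausdorff measure on positively separated sets, for balls: the balls of
  radius \<open>e / 4\<close> around \<open>e\<close>-separated centres are more than \<open>e / 4\<close> apart, so a covering set of
  diameter at most \<open>e / 4\<close> meets at most one of them. The factor \<open>\<pi> / 16\<close> converts the sums
  of \<open>4 * diam\<^sup>2\<close> that the content bounds use into the normalization \<open>\<pi> / 4 * diam\<^sup>2\<close>.\<close>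

lemma hausdorff2_separated_balls:
  fixes Z :: "'a metric"
  assumes F: "finite F" and e: "0 < e" and FZ: "F \<subseteq> mspace Z" and sep: "separated_set Z e F"
    and content: "\<And>x C. \<lbrakk>x \<in> F; \<And>i::nat. C i \<subseteq> mspace Z; mball_of Z x (e / 4) \<subseteq> (\<Union>i. C i)\<rbrakk>
       \<Longrightarrow> m \<le> (\<Sum>i. 4 * (ediam Z (C i))\<^sup>2)"
    and A: "(\<Union>x\<in>F. mball_of Z x (e / 4)) \<subseteq> A"
  shows "ennreal (pi / 16) * (of_nat (card F) * m) \<le> hausdorff2 Z A"
proof -
  have "ennreal (pi / 16) * (of_nat (card F) * m) \<le> hausdorff2_premeasure Z (e / 4) A"
    unfolding hausdorff2_premeasure_def
  proof (rule INF_greatest, clarify)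
    fix C :: "nat \<Rightarrow> 'a set"
    assume C: "\<forall>i. C i \<subseteq> mspace Z \<and> ediam Z (C i) \<le> ennreal (e / 4)" and AC: "A \<subseteq> (\<Union>i. C i)"
    define N where "N x i = (if C i \<inter> mball_of Z x (e / 4) = {} then {} else C i)" for x i
    have "of_nat (card F) * m = (\<Sum>x\<in>F. m)"
      by simp
    also have "\<dots> \<le> (\<Sum>x\<in>F. \<Sum>i. 4 * (ediam Z (N x i))\<^sup>2)"
    proof (rule sum_mono, rule content)
      fix x assume "x \<in> F"
      then have "mball_of Z x (e / 4) \<subseteq> (\<Union>i. C i)"
        using A AC by blast
      then show "mball_of Z x (e / 4) \<subseteq> (\<Union>i. N x i)"
        by (fastforce simp: N_def)
      show "N x i \<subseteq> mspace Z" for i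
        using C by (simp add: N_def)
    qed auto
    also have "\<dots> = (\<Sum>i. \<Sum>x\<in>F. 4 * (ediam Z (N x i))\<^sup>2)"
      by (rule suminf_sum[symmetric]) auto
    also have "\<dots> \<le> (\<Sum>i. 4 * (ediam Z (C i))\<^sup>2)"
    proof (rule suminf_le)
      fix i
      show "(\<Sum>x\<in>F. 4 * (ediam Z (N x i))\<^sup>2) \<le> 4 * (ediam Z (C i))\<^sup>2"
      proof (cases "\<exists>x\<in>F. N x i \<noteq> {}")
        case True
        then obtain x where x: "x \<in> F" "N x i \<noteq> {}" by blast
        have "N x' i = {}" if x': "x' \<in> F" "x' \<noteq> x" for x'
        proof (rule ccontr)
          assume "N x' i \<noteq> {}"
          then have "C i \<inter> mball_of Z x (e / 4) \<noteq> {}" "C i \<inter> mball_of Z x' (e / 4) \<noteq> {}"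
            using x(2) by (auto simp: N_def)
          then obtain p p' where p: "p \<in> C i" "p \<in> mball_of Z x (e / 4)"
            and p': "p' \<in> C i" "p' \<in> mball_of Z x' (e / 4)"
            by blast
          have "ennreal (mdist Z p p') \<le> ennreal (e / 4)"
            using mdist_le_ediam[OF p(1) p'(1), of Z] C order_trans by blast
          then have "mdist Z p p' \<le> e / 4"
            using e by simp
          moreover have "e \<le> mdist Z x x'"
            using sep x x' unfolding separated_set_def by metis
          ultimately show False
            using mdist_triangle[of x Z p x'] mdist_triangle[of p Z p' x'] p p' e
            by (simp add: mdist_commute)
        qed
        then have "(\<Sum>x\<in>F. 4 * (ediam Z (N x i))\<^sup>2) = (\<Sum>x\<in>{x}. 4 * (ediam Z (N x i))\<^sup>2)"
          using F x(1) by (intro sum.mono_neutral_right) auto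
        also have "\<dots> \<le> 4 * (ediam Z (C i))\<^sup>2"
          by (simp add: N_def)
        finally show ?thesis .
      next
        case False
        then show ?thesis by simp
      qed
    qed auto
    finally have "ennreal (pi / 16) * (of_nat (card F) * m) \<le> ennreal (pi / 16) * (\<Sum>i. 4 * (ediam Z (C i))\<^sup>2)"
      by (rule mult_left_mono) simp
    also have "\<dots> = (\<Sum>i. ennreal (pi / 16) * (4 * (ediam Z (C i))\<^sup>2))"
      by simp
    also have "\<dots> = (\<Sum>i. ennreal (pi / 4) * (ediam Z (C i))\<^sup>2)"
    proof -
      have "ennreal (pi / 16) * 4 = ennreal (pi / 4)"
        by (simp add: ennreal_mult'[symmetric] flip: ennreal_numeral)
      then show ?thesis
        by (simp add: mult.assoc[symmetric])
    qed
    finally show "ennreal (pi / 16) * (of_nat (card F) * m) \<le> (\<Sum>i. ennreal (pi / 4) * (ediam Z (C i))\<^sup>2)" .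
  qed
  also have "\<dots> \<le> hausdorff2 Z A"
    unfolding hausdorff2_def by (rule SUP_upper) (use e in auto)
  finally show ?thesis .
qed

text \<open>If balls centred on \<open>P\<close> have area comparable to the square of their radius, an \<open>\<epsilon> r\<close>-separated
  subset of a ball of radius \<open>r\<close> yields separated balls of area at least a multiple of \<open>(\<epsilon> r)\<^sup>2\<close> inside
  a ball of area at most a multiple of \<open>r\<^sup>2\<close>.\<close>

lemma assouad_dim_bounded_two:
  fixes Z :: "'a metric"
  assumes PZ: "P \<subseteq> mspace Z"
    and fin: "hausdorff2 Z (mspace Z) < \<infinity>" and CU: "0 < CU"
    and upper: "\<And>y r. \<lbrakk>y \<in> P; 0 < r; ennreal r < ediam Z P\<rbrakk> \<Longrightarrow> hausdorff2 Z (mcball_of Z y r) \<le> ennreal (CU * r\<^sup>2)"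
    and c: "0 < c"
    and lower: "\<And>y \<rho> C. \<lbrakk>y \<in> P; 0 < \<rho>; ennreal \<rho> < ediam Z P; \<And>i::nat. C i \<subseteq> mspace Z; mball_of Z y \<rho> \<subseteq> (\<Union>i. C i)\<rbrakk>
       \<Longrightarrow> ennreal (c * \<rho>\<^sup>2) \<le> (\<Sum>i. 4 * (ediam Z (C i))\<^sup>2)"
  shows "assouad_dim_bounded (submetric Z P) 2"
proof -
  \<comment> \<open>The enclosing ball has radius \<open>2 * r\<close>, where \<open>upper\<close> may no longer apply. In that case \<open>2 * r\<close> is at
    least the (finite) diameter \<open>D\<close> of \<open>P\<close>, and the finite total area accounts for the second summand
    of \<open>M\<close>.\<close>
  define D where "D = enn2real (ediam Z P)"
  define M where "M = 4 * CU + enn2real (hausdorff2 Z (mspace Z)) * 4 / D\<^sup>2"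
  have M: "0 < M"
    using CU by (auto simp: M_def intro!: add_pos_nonneg)
  have ball_bound: "hausdorff2 Z (mcball_of Z z (2 * r)) \<le> ennreal (M * r\<^sup>2)"
    if z: "z \<in> P" and r: "0 < r" "ennreal r < ediam Z P" for z r
  proof (cases "ennreal (2 * r) < ediam Z P")
    case True
    have "hausdorff2 Z (mcball_of Z z (2 * r)) \<le> ennreal (CU * (2 * r)\<^sup>2)"
      by (rule upper) (use True z r in auto)
    also have "\<dots> \<le> ennreal (M * r\<^sup>2)"
      by (intro ennreal_leI) (auto simp: M_def power_mult_distrib algebra_simps)
    finally show ?thesis .
  next
    case False
    then have "ediam Z P \<le> ennreal (2 * r)"
      by simp
    then have "ediam Z P = ennreal D"
      unfolding D_def by (metis ennreal_enn2real le_less_trans ennreal_less_top)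
    then have D: "0 < D" "D \<le> 2 * r"
      using r \<open>ediam Z P \<le> ennreal (2 * r)\<close> by (auto simp: ennreal_less_iff)
    have "hausdorff2 Z (mcball_of Z z (2 * r)) \<le> hausdorff2 Z (mspace Z)"
      by (rule hausdorff2_mono) auto
    also have "\<dots> = ennreal (enn2real (hausdorff2 Z (mspace Z)))"
      using fin by simp
    also have "\<dots> \<le> ennreal (M * r\<^sup>2)"
    proof (rule ennreal_leI)
      let ?h = "enn2real (hausdorff2 Z (mspace Z))"
      have "1 \<le> 4 * r\<^sup>2 / D\<^sup>2"
        using power_mono[OF D(2), of 2] D(1) by (simp add: power_mult_distrib)
      then have "?h * 1 \<le> ?h * (4 * r\<^sup>2 / D\<^sup>2)"
        by (rule mult_left_mono) simp
      also have "\<dots> \<le> M * r\<^sup>2"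
        using CU by (simp add: M_def algebra_simps)
      finally show "?h \<le> M * r\<^sup>2" by simp
    qed
    finally show ?thesis .
  qed
  define B where "B = 256 * M / (pi * c)"
  show ?thesis
    unfolding assouad_dim_bounded_def
  proof (intro exI[of _ "B"] allI impI, elim conjE)
    fix \<epsilon> z r S
    assume \<epsilon>: "0 < \<epsilon>" "\<epsilon> < 1" and z: "z \<in> mspace (submetric Z P)"
      and r: "0 < r" "ennreal r < ediam (submetric Z P) (mspace (submetric Z P))"
      and S: "S \<subseteq> mball_of (submetric Z P) z r" "separated_set (submetric Z P) (\<epsilon> * r) S"
    have z: "z \<in> P" "z \<in> mspace Z" and r: "0 < r" "ennreal r < ediam Z P"
      and SP: "S \<subseteq> P" and SB: "\<And>x. x \<in> S \<Longrightarrow> mdist Z z x < r"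
      using z r S PZ by (auto simp: ediam_def Int_absorb2)
    have er: "\<epsilon> * r < r" "0 < \<epsilon> * r"
      using \<epsilon> r by auto
    have bound: "real (card F) \<le> B * \<epsilon> powr (-2)" if F: "F \<subseteq> S" "finite F" for F
    proof -
      have "ennreal (pi / 16) * (of_nat (card F) * ennreal (c * (\<epsilon> * r / 4)\<^sup>2)) \<le> hausdorff2 Z (mcball_of Z z (2 * r))"
      proof (rule hausdorff2_separated_balls[OF F(2) er(2)])
        show "F \<subseteq> mspace Z"
          using F SP PZ by auto
        show "separated_set Z (\<epsilon> * r) F"
          using S(2) F(1) by (auto simp: separated_set_def)
        show "(\<Union>x\<in>F. mball_of Z x (\<epsilon> * r / 4)) \<subseteq> mcball_of Z z (2 * r)"
        proof clarsimp
          fix x p assume x: "x \<in> F" "x \<in> mspace Z" and p: "p \<in> mspace Z" "mdist Z x p * 4 < \<epsilon> * r"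
          then show "z \<in> mspace Z \<and> mdist Z z p \<le> 2 * r"
            using mdist_triangle[OF z(2) x(2) p(1)] SB[of x] F(1) er z by auto
        qed
        fix x and C :: "nat \<Rightarrow> 'a set"
        assume "x \<in> F" "\<And>i. C i \<subseteq> mspace Z" "mball_of Z x (\<epsilon> * r / 4) \<subseteq> (\<Union>i. C i)"
        moreover have "ennreal (\<epsilon> * r / 4) < ediam Z P"
          using er r by (intro le_less_trans[OF _ r(2)] ennreal_leI) linarith
        ultimately show "ennreal (c * (\<epsilon> * r / 4)\<^sup>2) \<le> (\<Sum>i. 4 * (ediam Z (C i))\<^sup>2)"
          using F(1) SP er by (intro lower) auto
      qed
      also have "\<dots> \<le> ennreal (M * r\<^sup>2)"
        by (rule ball_bound[OF z(1) r])
      also have "ennreal (pi / 16) * (of_nat (card F) * ennreal (c * (\<epsilon> * r / 4)\<^sup>2))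
          = ennreal (pi / 16 * (real (card F) * (c * (\<epsilon> * r / 4)\<^sup>2)))"
        using c by (simp add: ennreal_mult[symmetric] ennreal_of_nat_eq_real_of_nat)
      finally have "pi / 16 * (real (card F) * (c * (\<epsilon> * r / 4)\<^sup>2)) \<le> M * r\<^sup>2"
        using M r by (simp add: ennreal_le_iff)
      then have "real (card F) * (pi * c * \<epsilon>\<^sup>2) * r\<^sup>2 \<le> 256 * M * r\<^sup>2"
        by (simp add: power_mult_distrib power_divide algebra_simps)
      then have "real (card F) * (pi * c * \<epsilon>\<^sup>2) \<le> 256 * M"
        using r by simp
      then have "real (card F) \<le> B / \<epsilon>\<^sup>2"
        using c \<epsilon> by (simp add: B_def field_simps)
      also have "\<dots> = B * \<epsilon> powr (-2)"
        using \<epsilon> by (simp add: powr_minus divide_inverse powr_numeral)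
      finally show ?thesis .
    qed
    have "finite S \<and> card S \<le> nat \<lfloor>B * \<epsilon> powr (-2)\<rfloor>"
    proof (rule finite_if_finite_subsets_card_bdd)
      show "card F \<le> nat \<lfloor>B * \<epsilon> powr (-2)\<rfloor>" if "F \<subseteq> S" "finite F" for F
        using bound[OF that] by (simp add: le_nat_floor)
    qed
    then show "finite S \<and> real (card S) \<le> B * \<epsilon> powr - 2"
      using bound by auto
  qed
qed

theorem proposition1p4:
  fixes Y :: "'a metric" and Ybar :: "'b metric" and \<iota> :: "'a \<Rightarrow> 'b" and C\<^sub>U :: real
  assumes "quasiconformal_Jordan_domain Y Ybar \<iota>"
    and "quasicircle (metric_boundary Y Ybar \<iota>)"
    and "C\<^sub>U > 0"
    and "\<And>y r. \<lbrakk>y \<in> mspace (metric_boundary Y Ybar \<iota>); 0 < r;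
            ennreal r < ediam (metric_boundary Y Ybar \<iota>) (mspace (metric_boundary Y Ybar \<iota>))\<rbrakk>
          \<Longrightarrow> hausdorff2 Ybar (mcball_of Ybar y r) \<le> ennreal (C\<^sub>U * r ^ 2)"
  shows "assouad_dim (metric_boundary Y Ybar \<iota>) \<le> 2"
proof -
  define P where "P = mspace Ybar - \<iota> ` mspace Y"
  have PZ: "P \<subseteq> mspace Ybar"
    by (auto simp: P_def)
  have bd: "metric_boundary Y Ybar \<iota> = submetric Ybar P"
    by (simp add: metric_boundary_def P_def)
  have ediam_bd: "ediam (submetric Ybar P) (mspace (submetric Ybar P)) = ediam Ybar P"
    using PZ by (simp add: ediam_def Int_absorb2)
  have homZ: "mtopology_of Ybar homeomorphic_space mtopology_of closed_unit_disk"
    and fin: "hausdorff2 Ybar (mspace Ybar) < \<infinity>"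
    using assms(1) unfolding quasiconformal_Jordan_domain_def metric_Jordan_domain_def by blast+
  obtain g where "quasisymmetric unit_circle (submetric Ybar P) g"
    using assms(2) unfolding quasicircle_def bd by blast
  then obtain c where "0 < c"
    "\<And>y \<rho> C. \<lbrakk>y \<in> P; 0 < \<rho>; ennreal \<rho> < ediam Ybar P; \<And>i::nat. C i \<subseteq> mspace Ybar; mball_of Ybar y \<rho> \<subseteq> (\<Union>i. C i)\<rbrakk>
       \<Longrightarrow> ennreal (c * \<rho>\<^sup>2) \<le> (\<Sum>i. 4 * (ediam Ybar (C i))\<^sup>2)"
    using quasicircle_boundary_content_lower_bound[OF homZ PZ] by metis
  moreover have "hausdorff2 Ybar (mcball_of Ybar y r) \<le> ennreal (C\<^sub>U * r\<^sup>2)"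
    if "y \<in> P" "0 < r" "ennreal r < ediam Ybar P" for y r
    using assms(4)[unfolded bd ediam_bd] that PZ by auto
  ultimately have "assouad_dim_bounded (submetric Ybar P) 2"
    using assouad_dim_bounded_two[OF PZ fin assms(3)] by blast
  then have "assouad_dim (submetric Ybar P) \<le> ereal 2"
    unfolding assouad_dim_def by (intro INF_lower) auto
  then show ?thesis
    by (simp add: bd)
qed

end
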